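(* Let $H$ be a graph, let $G=KB(H)$, and let $q$ be a vertex of $G$ with $d_G(q)=2$. Then $G-\{q\}$ is a biclique graph; that is, there exists a graph $H'$ such that $G-\{q\}=KB(H')$.
   Context: All graphs are finite, simple, undirected and connected. A biclique of a graph $H$ is a maximal (with respect to vertex-set inclusion) set of vertices inducing a complete bipartite subgraph $K_{r,s}$ with $r,s\ge 1$. The biclique graph $KB(H)$ is the intersection graph of the family of all bicliques of $H$: its vertices are the bicliques of $H$, and two bicliques are adjacent iff they share at least one vertex. A graph $G$ is a biclique graph if $G=KB(H)$ (up to isomorphism) for some graph $H$. $d_G(q)$ denotes the degree of $q$ in $G$. *)

theory Defs
  imports Main
begin

text \<open>A graph is a pair (V, E): a vertex set and a set of 2-element edges.\<close>
type_synonym 'a graph = "'a set \<times> 'a set set"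

definition verts :: "'a graph \<Rightarrow> 'a set" where "verts H = fst H"
definition edges :: "'a graph \<Rightarrow> 'a set set" where "edges H = snd H"

definition adj :: "'a graph \<Rightarrow> 'a \<Rightarrow> 'a \<Rightarrow> bool" where
  "adj H u v \<longleftrightarrow> {u, v} \<in> edges H"

text \<open>Finite, simple, undirected (and nonempty) graph.\<close>
definition simple_graph :: "'a graph \<Rightarrow> bool" where
  "simple_graph H \<longleftrightarrow> finite (verts H) \<and> verts H \<noteq> {} \<and>
     (\<forall>e \<in> edges H. \<exists>u v. e = {u, v} \<and> u \<noteq> v \<and> u \<in> verts H \<and> v \<in> verts H)"

definition connected_graph :: "'a graph \<Rightarrow> bool" where
  "connected_graph H \<longleftrightarrow>
     (\<forall>u \<in> verts H. \<forall>v \<in> verts H. (u, v) \<in> {(x, y). adj H x y}\<^sup>*)"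

text \<open>Standing convention: all graphs are finite, simple, undirected and connected.\<close>
definition graph :: "'a graph \<Rightarrow> bool" where
  "graph H \<longleftrightarrow> simple_graph H \<and> connected_graph H"

text \<open>S induces a complete bipartite graph K_{r,s} with r, s \<ge> 1.\<close>
definition induces_complete_bipartite :: "'a graph \<Rightarrow> 'a set \<Rightarrow> bool" where
  "induces_complete_bipartite H S \<longleftrightarrow> S \<subseteq> verts H \<and>
     (\<exists>X Y. X \<noteq> {} \<and> Y \<noteq> {} \<and> X \<inter> Y = {} \<and> X \<union> Y = S \<and>
        (\<forall>x \<in> X. \<forall>y \<in> Y. adj H x y) \<and>
        (\<forall>x \<in> X. \<forall>x' \<in> X. \<not> adj H x x') \<and>
        (\<forall>y \<in> Y. \<forall>y' \<in> Y. \<not> adj H y y'))"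

definition biclique :: "'a graph \<Rightarrow> 'a set \<Rightarrow> bool" where
  "biclique H S \<longleftrightarrow> induces_complete_bipartite H S \<and>
     (\<forall>T. induces_complete_bipartite H T \<and> S \<subseteq> T \<longrightarrow> T = S)"

text \<open>The biclique graph KB(H): intersection graph of the bicliques of H.\<close>
definition KB :: "'a graph \<Rightarrow> 'a set graph" where
  "KB H = ({B. biclique H B},
           {{B1, B2} | B1 B2. biclique H B1 \<and> biclique H B2 \<and> B1 \<noteq> B2 \<and> B1 \<inter> B2 \<noteq> {}})"

definition degree :: "'a graph \<Rightarrow> 'a \<Rightarrow> nat" where
  "degree G q = card {p \<in> verts G. adj G q p}"

text \<open>G - {q}: delete vertex q and all incident edges.\<close>
definition delete_vertex :: "'a graph \<Rightarrow> 'a \<Rightarrow> 'a graph" where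
  "delete_vertex G q = (verts G - {q}, {e \<in> edges G. q \<notin> e})"

definition graph_iso :: "'a graph \<Rightarrow> 'b graph \<Rightarrow> bool" where
  "graph_iso G G' \<longleftrightarrow> (\<exists>f. bij_betw f (verts G) (verts G') \<and>
     (\<forall>u \<in> verts G. \<forall>v \<in> verts G. adj G u v \<longleftrightarrow> adj G' (f u) (f v)))"

text \<open>G is a biclique graph if G \<cong> KB(H) for some graph H. Since graphs are
  finite, H may be taken with vertices in nat without loss of generality.\<close>
definition biclique_graph :: "'a graph \<Rightarrow> bool" where
  "biclique_graph G \<longleftrightarrow> (\<exists>H :: nat graph. graph H \<and> graph_iso G (KB H))"

end

theory Submission
  imports Defs
begin

text \<open>
  Let a and b be the two other bicliques meeting q. Every induced star meeting q lies inside q, a or b;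
  this leaves little freedom around q.
  If q \<inter> b \<subseteq> a (or symmetrically), the vertices of q - a lie in no other biclique, and deleting
  them from H destroys q and nothing else.
  Otherwise either no edge leaves a or b except into q, so that H has no further biclique and
  KB(H) - q is a single edge, realised by a path on four vertices; or q, a and b have the form
  X \<union> Y, X \<union> V \<union> Z and Y \<union> V \<union> Z, where X, Y, Z are mutually complete classes and only V has
  neighbours elsewhere. In this last case one removes the edges at Y, joins Y to V, so that Y
  becomes a twin of Z towards the rest of the graph, and adds one new vertex adjacent to Y and Z.
\<close>

section \<open>Bicliques as two-coloured sets\<close>

text \<open>A star is complete bipartite, so it extends to a biclique; if it meets q, that biclique
  is q, a or b because q has degree two. A star meeting q that sticks out of all three sets is
  therefore impossible, and the structure around q is forced by exhibiting such stars. The obstacle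
  is the last case. No vertex is private to q there: X lies in a and Y in b, and deleting all of Y
  would also lose b, whose remainder V \<union> Z lies inside a. Deleting only the edges between X
  and Y fails too, since Z against X \<union> Y \<union> V would become complete bipartite and fuse
  a with b. Placing Y beside Z, facing V, keeps them apart: the image of a still has Z against X
  \<union> V, that of b has Y \<union> Z against V. Other bicliques through Z gain Y, which creates
  no new intersections because they share Z already. A second constraint is that the new graph must
  be connected, so both modifications of H come with a map from H along which walks can be
  followed.\<close>

lemma adj_commute: "adj H u v \<longleftrightarrow> adj H v u"
  by (simp add: adj_def insert_commute)

lemma simple_graph_adj:
  assumes "simple_graph H" and "adj H u v"
  shows "u \<in> verts H" and "v \<in> verts H" and "u \<noteq> v"
  using assms unfolding simple_graph_def adj_def by (fastforce simp: doubleton_eq_iff)+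

lemma adj_KB:
  "adj (KB H) B C \<longleftrightarrow> biclique H B \<and> biclique H C \<and> B \<noteq> C \<and> B \<inter> C \<noteq> {}"
  unfolding adj_def KB_def edges_def by (auto simp: doubleton_eq_iff)

lemma verts_KB: "verts (KB H) = {B. biclique H B}"
  by (simp add: KB_def verts_def)

lemma verts_delete_vertex: "verts (delete_vertex G q) = verts G - {q}"
  by (simp add: delete_vertex_def verts_def)

lemma adj_delete_vertex:
  "adj (delete_vertex G q) u v \<longleftrightarrow> adj G u v \<and> u \<noteq> q \<and> v \<noteq> q"
  by (auto simp: delete_vertex_def adj_def edges_def)

text \<open>One Boolean colour replaces the pair of sides: inside S adjacency becomes a single
  equivalence, and giving a bipartition means giving a predicate on vertices.\<close>

lemma induces_complete_bipartite_iff_colouring: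
  "induces_complete_bipartite H S \<longleftrightarrow> S \<subseteq> verts H \<and>
     (\<exists>c :: 'a \<Rightarrow> bool. (\<forall>u\<in>S. \<forall>v\<in>S. adj H u v \<longleftrightarrow> c u \<noteq> c v) \<and>
        (\<exists>u\<in>S. c u) \<and> (\<exists>u\<in>S. \<not> c u))"
  (is "_ \<longleftrightarrow> _ \<and> ?R")
proof (intro iffI conjI)
  assume l: "induces_complete_bipartite H S"
  show "S \<subseteq> verts H" using l by (simp add: induces_complete_bipartite_def)
  from l obtain X Y where XY: "X \<noteq> {}" "Y \<noteq> {}" "X \<inter> Y = {}" "X \<union> Y = S"
    "\<forall>x \<in> X. \<forall>y \<in> Y. adj H x y" "\<forall>x \<in> X. \<forall>x' \<in> X. \<not> adj H x x'"
    "\<forall>y \<in> Y. \<forall>y' \<in> Y. \<not> adj H y y'"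
    unfolding induces_complete_bipartite_def by blast
  have "\<forall>u\<in>S. \<forall>v\<in>S. adj H u v \<longleftrightarrow> (u \<in> X) \<noteq> (v \<in> X)"
  proof (intro ballI)
    fix u v assume "u \<in> S" "v \<in> S"
    then show "adj H u v \<longleftrightarrow> (u \<in> X) \<noteq> (v \<in> X)"
      using XY adj_commute[of H u v] by blast
  qed
  moreover have "\<exists>u\<in>S. u \<in> X" "\<exists>u\<in>S. u \<notin> X" using XY by blast+
  ultimately show ?R by (intro exI[of _ "\<lambda>u. u \<in> X"]) blast
next
  assume r: "S \<subseteq> verts H \<and> ?R"
  then obtain c where c: "\<And>u v. u \<in> S \<Longrightarrow> v \<in> S \<Longrightarrow> adj H u v \<longleftrightarrow> c u \<noteq> (c v :: bool)"
    "\<exists>u\<in>S. c u" "\<exists>u\<in>S. \<not> c u"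
    by blast
  have "S \<subseteq> verts H" using r by blast
  then show "induces_complete_bipartite H S"
    unfolding induces_complete_bipartite_def
    apply (intro conjI, assumption)
    apply (rule exI[of _ "{u\<in>S. c u}"], rule exI[of _ "{u\<in>S. \<not> c u}"])
    using c by auto
qed

lemma complete_bipartiteI:
  fixes c :: "'a \<Rightarrow> bool"
  assumes "S \<subseteq> verts H" "\<And>u v. u \<in> S \<Longrightarrow> v \<in> S \<Longrightarrow> adj H u v \<longleftrightarrow> c u \<noteq> c v"
    "\<exists>u\<in>S. c u" "\<exists>u\<in>S. \<not> c u"
  shows "induces_complete_bipartite H S"
  unfolding induces_complete_bipartite_iff_colouring using assms by blast

lemma complete_bipartiteE:
  assumes "induces_complete_bipartite H S"
  obtains c :: "'a \<Rightarrow> bool" where "S \<subseteq> verts H"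
    "\<forall>u\<in>S. \<forall>v\<in>S. adj H u v \<longleftrightarrow> c u \<noteq> c v"
    "\<exists>u\<in>S. c u" "\<exists>u\<in>S. \<not> c u"
proof -
  from assms have "S \<subseteq> verts H" and "\<exists>c :: 'a \<Rightarrow> bool. (\<forall>u\<in>S. \<forall>v\<in>S. adj H u v \<longleftrightarrow> c u \<noteq> c v) \<and>
        (\<exists>u\<in>S. c u) \<and> (\<exists>u\<in>S. \<not> c u)"
    unfolding induces_complete_bipartite_iff_colouring by simp_all
  then show ?thesis using that by blast
qed

lemma bicliqueE:
  assumes "biclique H S"
  obtains c :: "'a \<Rightarrow> bool" where "S \<subseteq> verts H"
    "\<forall>u\<in>S. \<forall>v\<in>S. adj H u v \<longleftrightarrow> c u \<noteq> c v"
    "\<exists>u\<in>S. c u" "\<exists>u\<in>S. \<not> c u"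
  by (rule complete_bipartiteE[of H S]) (use assms that in \<open>auto simp: biclique_def\<close>)

lemma biclique_subset_verts: "biclique H S \<Longrightarrow> S \<subseteq> verts H"
  by (simp add: biclique_def induces_complete_bipartite_def)

lemma biclique_maximal:
  "biclique H S \<Longrightarrow> induces_complete_bipartite H T \<Longrightarrow> S \<subseteq> T \<Longrightarrow> T = S"
  by (simp add: biclique_def)

lemma biclique_subset_eq: "biclique H S \<Longrightarrow> biclique H T \<Longrightarrow> S \<subseteq> T \<Longrightarrow> S = T"
  by (auto simp: biclique_def)

text \<open>The complete bipartite sets form a finite family of subsets of \<open>verts H\<close>,
  so each of them lies below a maximal one.\<close>

lemma complete_bipartite_extends:
  assumes "simple_graph H" and S: "induces_complete_bipartite H S"
  obtains B where "biclique H B" and "S \<subseteq> B"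
proof -
  let ?A = "{T. induces_complete_bipartite H T}"
  have "?A \<subseteq> Pow (verts H)" by (auto simp: induces_complete_bipartite_def)
  then have "finite ?A" using assms(1) by (meson finite_Pow_iff finite_subset simple_graph_def)
  from finite_has_maximal2[OF this, of S] S obtain B
    where "B \<in> ?A" "S \<subseteq> B" "\<forall>T\<in>?A. B \<subseteq> T \<longrightarrow> B = T" by auto
  then show ?thesis by (intro that) (auto simp: biclique_def)
qed

text \<open>This turns local adjacencies into statements on bicliques: the centre v forms one side
  and the independent set L the other.\<close>

lemma star_in_biclique:
  assumes H: "simple_graph H" and "L \<noteq> {}" and adj: "\<And>u. u \<in> L \<Longrightarrow> adj H u v"
    and ind: "\<And>u w. u \<in> L \<Longrightarrow> w \<in> L \<Longrightarrow> \<not> adj H u w"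
  obtains B where "biclique H B" "insert v L \<subseteq> B"
proof -
  have "v \<notin> L" using adj ind by blast
  have "induces_complete_bipartite H (insert v L)"
  proof (rule complete_bipartiteI[where c = "\<lambda>u. u = v"])
    show "insert v L \<subseteq> verts H" using simple_graph_adj[OF H adj] \<open>L \<noteq> {}\<close> by blast
    show "adj H u w \<longleftrightarrow> (u = v) \<noteq> (w = v)" if "u \<in> insert v L" "w \<in> insert v L" for u w
      using that adj ind adj_commute[of H] simple_graph_adj(3)[OF H] by blast
  qed (use \<open>L \<noteq> {}\<close> \<open>v \<notin> L\<close> in auto)
  then show ?thesis using complete_bipartite_extends[OF H] that by blast
qed

section \<open>Realising biclique graphs\<close>

text \<open>Bicliques are the maximal complete bipartite sets. An antichain of complete bipartite
  sets that covers all others consists of exactly the maximal ones, so \<open>cover\<close> and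
  \<open>anti\<close> identify every biclique of H without a separate maximality argument.
  \<open>anti\<close> also makes f injective. The diagonal is treated apart because a biclique meets
  itself but is not its own neighbour.\<close>

lemma graph_iso_KB:
  assumes "verts G = F" and "\<And>B. B \<in> F \<Longrightarrow> \<not> adj G B B"
    and cb: "\<And>B. B \<in> F \<Longrightarrow> induces_complete_bipartite H (f B)"
    and cover: "\<And>T. induces_complete_bipartite H T \<Longrightarrow> \<exists>B\<in>F. T \<subseteq> f B"
    and anti: "\<And>B C. B \<in> F \<Longrightarrow> C \<in> F \<Longrightarrow> f B \<subseteq> f C \<Longrightarrow> B = C"
    and inter: "\<And>B C. B \<in> F \<Longrightarrow> C \<in> F \<Longrightarrow> B \<noteq> C \<Longrightarrow> adj G B C \<longleftrightarrow> f B \<inter> f C \<noteq> {}"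
  shows "graph_iso G (KB H)"
proof -
  have b: "biclique H (f B)" if "B \<in> F" for B
    unfolding biclique_def using that cb cover anti by (metis subset_antisym subset_trans)
  have s: "\<exists>B\<in>F. T = f B" if "biclique H T" for T
    using that cb cover unfolding biclique_def by metis
  have inj: "inj_on f F" using anti by (simp add: inj_on_def)
  then have "bij_betw f F {B. biclique H B}"
    unfolding bij_betw_def using b s by auto
  then show ?thesis
    unfolding graph_iso_def
    using assms(1,2) b inter inj
    by (intro exI[of _ f]) (auto simp: verts_KB adj_KB inj_on_eq_iff)
qed

text \<open>Walks of H are carried to walks of H'. An edge needs only a walk as its image, since the
  map may send edges of H to pairs that are no longer adjacent.\<close>

lemma connected_graph_map:
  assumes H: "connected_graph H"
    and edge: "\<And>u v. adj H u v \<Longrightarrow> (f u, f v) \<in> {(x, y). adj H' x y}\<^sup>*"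
    and reach: "\<And>w. w \<in> verts H' \<Longrightarrow> \<exists>u\<in>verts H. (f u, w) \<in> {(x, y). adj H' x y}\<^sup>*"
  shows "connected_graph H'"
proof -
  let ?R = "{(x, y). adj H x y}" and ?R' = "{(x, y). adj H' x y}"
  have "sym (?R'\<^sup>*)"
    by (rule sym_rtrancl) (use adj_commute[of H'] in \<open>auto simp: sym_def\<close>)
  have im: "(f u, f v) \<in> ?R'\<^sup>*" if "(u, v) \<in> ?R\<^sup>*" for u v
    using that by induction (auto intro: rtrancl_trans edge)
  show ?thesis unfolding connected_graph_def
  proof (intro ballI)
    fix w z assume "w \<in> verts H'" "z \<in> verts H'"
    then obtain u v where "u \<in> verts H" "v \<in> verts H" "(f u, w) \<in> ?R'\<^sup>*" "(f v, z) \<in> ?R'\<^sup>*"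
      using reach by metis
    moreover have "(f u, f v) \<in> ?R'\<^sup>*"
      using im H calculation(1,2) unfolding connected_graph_def by blast
    ultimately show "(w, z) \<in> ?R'\<^sup>*"
      using \<open>sym (?R'\<^sup>*)\<close> by (meson rtrancl_trans symD)
  qed
qed

lemma graph_iso_trans:
  assumes "graph_iso G G'" "graph_iso G' G''"
  shows "graph_iso G G''"
proof -
  obtain f g where f: "bij_betw f (verts G) (verts G')"
      "\<forall>u \<in> verts G. \<forall>v \<in> verts G. adj G u v \<longleftrightarrow> adj G' (f u) (f v)"
    and g: "bij_betw g (verts G') (verts G'')"
      "\<forall>u \<in> verts G'. \<forall>v \<in> verts G'. adj G' u v \<longleftrightarrow> adj G'' (g u) (g v)"
    using assms unfolding graph_iso_def by blast
  show ?thesis unfolding graph_iso_def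
    by (intro exI[of _ "g \<circ> f"] conjI bij_betw_trans[OF f(1) g(1)])
      (use f g bij_betwE[OF f(1)] in auto)
qed

text \<open>The relation is cut down to V here, so an induced subgraph arises by shrinking V alone.
  Edges are unordered pairs, hence the symmetry hypothesis in \<open>adj_graph_of\<close>.\<close>

definition graph_of :: "'a set \<Rightarrow> ('a \<Rightarrow> 'a \<Rightarrow> bool) \<Rightarrow> 'a graph" where
  "graph_of V r = (V, {{u, v} | u v. u \<in> V \<and> v \<in> V \<and> r u v})"

lemma verts_graph_of [simp]: "verts (graph_of V r) = V"
  by (simp add: graph_of_def verts_def)

lemma adj_graph_of:
  assumes "\<And>u v. r u v \<Longrightarrow> r v u"
  shows "adj (graph_of V r) u v \<longleftrightarrow> u \<in> V \<and> v \<in> V \<and> r u v"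
  using assms unfolding adj_def graph_of_def edges_def by (auto simp: doubleton_eq_iff)

lemma simple_graph_of:
  assumes "finite V" "V \<noteq> {}" "\<And>u. \<not> r u u"
  shows "simple_graph (graph_of V r)"
  using assms unfolding simple_graph_def by (auto simp: graph_of_def edges_def verts_def)

text \<open>\<open>biclique_graph\<close> asks for vertices in \<open>nat\<close>, while the
  constructions below live on \<open>'a\<close> or \<open>'a option\<close>. A finite vertex set is
  relabelled along an injection g, and the bicliques of the copy are the images under g.\<close>

lemma biclique_graphI:
  fixes H :: "'b graph"
  assumes H: "graph H" and iso: "graph_iso G (KB H)"
  shows "biclique_graph G"
proof -
  have sH: "simple_graph H" and cH: "connected_graph H" using H by (auto simp: graph_def)
  then obtain g :: "'b \<Rightarrow> nat" where g: "inj_on g (verts H)"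
    by (meson finite_imp_inj_to_nat_seg simple_graph_def)
  define r where "r m n \<longleftrightarrow> (\<exists>u v. m = g u \<and> n = g v \<and> adj H u v)" for m n
  define H' where "H' = graph_of (g ` verts H) r"
  have r: "r (g u) (g v) \<longleftrightarrow> adj H u v" if "u \<in> verts H" "v \<in> verts H" for u v
    unfolding r_def using that g simple_graph_adj[OF sH] by (metis inj_onD)
  have rs: "r m n \<Longrightarrow> r n m" for m n unfolding r_def using adj_commute[of H] by blast
  have vH': "verts H' = g ` verts H" by (simp add: H'_def)
  have aH': "adj H' (g u) (g v) \<longleftrightarrow> adj H u v" if "u \<in> verts H" "v \<in> verts H" for u v
    using that r by (simp add: H'_def adj_graph_of[OF rs])
  have "simple_graph H'" unfolding H'_def
  proof (rule simple_graph_of)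
    show "\<not> r m m" for m
      unfolding r_def using g simple_graph_adj[OF sH] by (metis inj_onD)
  qed (use sH in \<open>auto simp: simple_graph_def\<close>)
  moreover have "connected_graph H'"
  proof (rule connected_graph_map[OF cH])
    show "(g u, g v) \<in> {(x, y). adj H' x y}\<^sup>*" if "adj H u v" for u v
      using that aH' simple_graph_adj[OF sH that] by blast
  qed (auto simp: vH')
  ultimately have gH': "graph H'" by (simp add: graph_def)
  have "graph_iso (KB H) (KB H')"
  proof (rule graph_iso_KB[where f = "(`) g" and F = "{B. biclique H B}"])
    show "induces_complete_bipartite H' (g ` B)" if "B \<in> {B. biclique H B}" for B
    proof -
      from that obtain c where c: "B \<subseteq> verts H"
          "\<forall>u\<in>B. \<forall>v\<in>B. adj H u v \<longleftrightarrow> c u \<noteq> (c v :: bool)"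
          "\<exists>u\<in>B. c u" "\<exists>u\<in>B. \<not> c u"
        using bicliqueE by blast
      have inv: "inv_into (verts H) g (g u) = u" if "u \<in> B" for u
        using that c(1) g by auto
      show ?thesis
        by (rule complete_bipartiteI[where c = "c \<circ> inv_into (verts H) g"])
          (use c inv aH' in \<open>auto simp: vH' subset_iff\<close>)
    qed
    show "\<exists>B\<in>{B. biclique H B}. T \<subseteq> g ` B" if T: "induces_complete_bipartite H' T" for T
    proof -
      from T obtain c where c: "T \<subseteq> verts H'"
          "\<forall>u\<in>T. \<forall>v\<in>T. adj H' u v \<longleftrightarrow> c u \<noteq> (c v :: bool)"
          "\<exists>u\<in>T. c u" "\<exists>u\<in>T. \<not> c u"
        using complete_bipartiteE by blast
      define S where "S = {u \<in> verts H. g u \<in> T}"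
      have TS: "T = g ` S" using c(1) by (auto simp: S_def vH')
      have "induces_complete_bipartite H S"
      proof (rule complete_bipartiteI[where c = "c \<circ> g"])
        show "adj H u v \<longleftrightarrow> (c \<circ> g) u \<noteq> (c \<circ> g) v" if "u \<in> S" "v \<in> S" for u v
          using that c(2)[rule_format, of "g u" "g v"] aH'[of u v] by (simp add: S_def)
        show "\<exists>u\<in>S. (c \<circ> g) u" "\<exists>u\<in>S. \<not> (c \<circ> g) u"
          using c(3,4) unfolding TS by auto
      qed (simp add: S_def)
      then obtain B where "biclique H B" "S \<subseteq> B"
        using complete_bipartite_extends[OF sH] by blast
      then show ?thesis using TS by blast
    qed
    show "B = C" if "B \<in> {B. biclique H B}" "C \<in> {B. biclique H B}" "g ` B \<subseteq> g ` C" for B C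
    proof -
      have "B \<subseteq> C"
        using that biclique_subset_verts[of H] inj_on_image_mem_iff[OF g, of _ C] by blast
      then show ?thesis using that biclique_subset_eq by blast
    qed
    show "adj (KB H) B C \<longleftrightarrow> g ` B \<inter> g ` C \<noteq> {}"
      if "B \<in> {B. biclique H B}" "C \<in> {B. biclique H B}" "B \<noteq> C" for B C
      using that inj_on_image_Int[OF g, of B C] biclique_subset_verts[of H] by (auto simp: adj_KB)
  qed (auto simp: verts_KB adj_KB)
  then show ?thesis
    unfolding biclique_graph_def using gH' graph_iso_trans[OF iso] by blast
qed

text \<open>The path 0 - 1 - 2 - 3 has exactly two bicliques, the stars around its inner vertices 1
  and 2, and they share the middle edge.\<close>

lemma biclique_graph_K2:
  assumes V: "verts G = {a, b}" and "a \<noteq> b" "adj G a b" "\<not> adj G a a" "\<not> adj G b b"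
  shows "biclique_graph G"
proof -
  define r where "r m n \<longleftrightarrow> m = Suc n \<or> n = Suc m" for m n :: nat
  define H where "H = graph_of {0, 1, 2, 3} r"
  have rs: "r m n \<Longrightarrow> r n m" for m n by (auto simp: r_def)
  have aH: "adj H m n \<longleftrightarrow> m \<in> {0, 1, 2, 3} \<and> n \<in> {0, 1, 2, 3} \<and> r m n" for m n
    unfolding H_def by (rule adj_graph_of[OF rs])
  have vH: "verts H = {0, 1, 2, 3}" by (simp add: H_def)
  have "simple_graph H" unfolding H_def by (rule simple_graph_of) (auto simp: r_def)
  moreover have "connected_graph H"
  proof -
    let ?R = "{(x, y). adj H x y}"
    have e: "(0, 1) \<in> ?R\<^sup>*" "(1, 2) \<in> ?R\<^sup>*" "(2, 3) \<in> ?R\<^sup>*"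
      by (auto simp: aH r_def)
    have z: "(0, n) \<in> ?R\<^sup>*" if "n \<in> verts H" for n
      using that e unfolding vH by (auto intro: rtrancl_trans)
    have "sym (?R\<^sup>*)"
      by (rule sym_rtrancl) (use adj_commute[of H] in \<open>auto simp: sym_def\<close>)
    then show ?thesis unfolding connected_graph_def by (meson z rtrancl_trans symD)
  qed
  ultimately have gH: "graph H" by (simp add: graph_def)
  have ba: "adj G b a" using \<open>adj G a b\<close> adj_commute[of G] by blast
  define f :: "'a \<Rightarrow> nat set" where "f x = (if x = a then {0, 1, 2} else {1, 2, 3})" for x
  have fa: "f a = {0, 1, 2}" and fb: "f b = {1, 2, 3}" using \<open>a \<noteq> b\<close> by (auto simp: f_def)
  have "induces_complete_bipartite H {0, 1, 2}"
  proof (rule complete_bipartiteI[where c = "\<lambda>n. n = 1"])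
    have "\<forall>u\<in>{0, 1, 2}. \<forall>v\<in>{0, 1, 2}. adj H u v \<longleftrightarrow> (u = 1) \<noteq> (v = 1)"
      by (simp add: aH r_def)
    then show "adj H u v \<longleftrightarrow> (u = 1) \<noteq> (v = 1)" if "u \<in> {0, 1, 2}" "v \<in> {0, 1, 2}" for u v
      using that by blast
  qed (auto simp: vH)
  moreover have "induces_complete_bipartite H {1, 2, 3}"
  proof (rule complete_bipartiteI[where c = "\<lambda>n. n = 2"])
    have "\<forall>u\<in>{1, 2, 3}. \<forall>v\<in>{1, 2, 3}. adj H u v \<longleftrightarrow> (u = 2) \<noteq> (v = 2)"
      by (simp add: aH r_def)
    then show "adj H u v \<longleftrightarrow> (u = 2) \<noteq> (v = 2)" if "u \<in> {1, 2, 3}" "v \<in> {1, 2, 3}" for u v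
      using that by blast
  qed (auto simp: vH)
  ultimately have cb: "induces_complete_bipartite H (f B)" for B
    by (simp add: f_def)
  have "graph_iso G (KB H)"
  proof (rule graph_iso_KB[where f = f, OF V])
    show "induces_complete_bipartite H (f B)" for B by (rule cb)
    show "\<exists>B\<in>{a, b}. T \<subseteq> f B" if T: "induces_complete_bipartite H T" for T
    proof -
      from T obtain c where c: "T \<subseteq> {0, 1, 2, 3}"
          "\<forall>u\<in>T. \<forall>v\<in>T. adj H u v \<longleftrightarrow> c u \<noteq> (c v :: bool)"
          "\<exists>u\<in>T. c u" "\<exists>u\<in>T. \<not> c u"
        unfolding vH[symmetric] using complete_bipartiteE by blast
      \<comment> \<open>The end vertices are not adjacent, so they would be on the same side of T
        and have a common neighbour, which the path does not offer.\<close>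
      have "\<not> (0 \<in> T \<and> 3 \<in> T)"
      proof
        assume T: "0 \<in> T \<and> 3 \<in> T"
        then have "c 0 = c 3" using c(2)[rule_format, of 0 3] by (simp add: aH r_def)
        obtain n where n: "n \<in> T" "c n \<noteq> c 0" using c(3,4) by metis
        then have "adj H 0 n" "adj H 3 n" using c(2) T \<open>c 0 = c 3\<close> by metis+
        then show False by (simp add: aH r_def)
      qed
      then consider "T \<subseteq> {0, 1, 2}" | "T \<subseteq> {1, 2, 3}" using c(1) by blast
      then show ?thesis using \<open>a \<noteq> b\<close> by cases (auto simp: f_def)
    qed
    have sub: "\<not> {0, 1, 2} \<subseteq> {1, 2, 3 :: nat}" "\<not> {1, 2, 3} \<subseteq> {0, 1, 2 :: nat}"
      and int: "{0, 1, 2} \<inter> {1, 2, 3 :: nat} \<noteq> {}" by auto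
    show "B = C" if "B \<in> {a, b}" "C \<in> {a, b}" "f B \<subseteq> f C" for B C
      using that fa fb sub by (metis insertE singletonD)
    show "adj G B C \<longleftrightarrow> f B \<inter> f C \<noteq> {}" if "B \<in> {a, b}" "C \<in> {a, b}" "B \<noteq> C" for B C
      using that fa fb int ba \<open>adj G a b\<close> by (metis insertE singletonD inf_commute)
  qed (use assms(4,5) in blast)
  then show ?thesis unfolding biclique_graph_def using gH by blast
qed

section \<open>The neighbourhood of a biclique of degree two\<close>

text \<open>\<open>distinct\<close>, \<open>meet\<close> and \<open>only\<close> express that a and
  b are precisely the neighbours of q in KB(H). The conditions are symmetric in a and b, so by
  \<open>swap\<close> each result holds with the two exchanged.\<close>

locale degree_two_biclique =
  fixes H :: "'a graph" and q a b :: "'a set"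
  assumes graph: "graph H"
    and bicliques: "biclique H q" "biclique H a" "biclique H b"
    and distinct: "q \<noteq> a" "q \<noteq> b" "a \<noteq> b"
    and meet: "q \<inter> a \<noteq> {}" "q \<inter> b \<noteq> {}"
    and only: "\<And>B. biclique H B \<Longrightarrow> B \<inter> q \<noteq> {} \<Longrightarrow> B = q \<or> B = a \<or> B = b"
begin

lemma swap: "degree_two_biclique H q b a"
  using degree_two_biclique_axioms unfolding degree_two_biclique_def by metis

lemma simple: "simple_graph H" and connected: "connected_graph H"
  using graph by (auto simp: graph_def)

lemma irrefl: "\<not> adj H u u"
  using simple_graph_adj(3)[OF simple] by blast

section \<open>Stars that meet q\<close>

lemma star_cases:
  assumes "L \<noteq> {}" "\<And>u. u \<in> L \<Longrightarrow> adj H u v" "\<And>u w. u \<in> L \<Longrightarrow> w \<in> L \<Longrightarrow> \<not> adj H u w"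
    and "insert v L \<inter> q \<noteq> {}"
  shows "insert v L \<subseteq> q \<or> insert v L \<subseteq> a \<or> insert v L \<subseteq> b"
proof -
  obtain B where B: "biclique H B" "insert v L \<subseteq> B"
    using star_in_biclique[OF simple assms(1-3)] by blast
  then have "B \<inter> q \<noteq> {}" using assms(4) by blast
  then show ?thesis using only[OF B(1)] B(2) by metis
qed

text \<open>An edge is a star with one leaf; \<open>path_cases\<close> and \<open>claw_cases\<close>
  are the same observation for two and three leaves.\<close>

lemma edge_cases:
  assumes "adj H u v" "u \<in> q"
  shows "v \<in> q \<or> u \<in> a \<and> v \<in> a \<or> u \<in> b \<and> v \<in> b"
proof -
  have "{v, u} \<subseteq> q \<or> {v, u} \<subseteq> a \<or> {v, u} \<subseteq> b"
    by (rule star_cases) (use assms irrefl adj_commute[of H] in auto)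
  then show ?thesis by auto
qed

lemma path_cases:
  assumes "adj H u v" "adj H v w" "\<not> adj H u w" "u \<in> q \<or> v \<in> q \<or> w \<in> q"
  shows "u \<in> q \<and> v \<in> q \<and> w \<in> q \<or> u \<in> a \<and> v \<in> a \<and> w \<in> a \<or> u \<in> b \<and> v \<in> b \<and> w \<in> b"
proof -
  have "{v, u, w} \<subseteq> q \<or> {v, u, w} \<subseteq> a \<or> {v, u, w} \<subseteq> b"
    by (rule star_cases)
    (use assms irrefl adj_commute[of H w u] adj_commute[of H w v] in auto)
  then show ?thesis by auto
qed

lemma claw_cases:
  assumes "adj H u v" "adj H w v" "adj H x v" "\<not> adj H u w" "\<not> adj H u x" "\<not> adj H w x" "v \<in> q"
  shows "{v, u, w, x} \<subseteq> q \<or> {v, u, w, x} \<subseteq> a \<or> {v, u, w, x} \<subseteq> b"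
proof (rule star_cases)
  have "\<not> adj H w u" "\<not> adj H x u" "\<not> adj H x w"
    using assms adj_commute[of H] by blast+
  then show "\<not> adj H y z" if "y \<in> {u, w, x}" "z \<in> {u, w, x}" for y z
    using that assms(4-6) irrefl by (metis insertE singletonD)
  show "y \<in> {u, w, x} \<Longrightarrow> adj H y v" for y using assms(1-3) by blast
  show "insert v {u, w, x} \<inter> q \<noteq> {}" using assms(7) by blast
qed simp

text \<open>Take x in q \<inter> a and s in a - q. If they are on the same side of a, any z on the
  other side is adjacent to both, and one of the edges x z and z s crosses the boundary of q,
  depending on whether z is in q.\<close>

lemma boundary_edge:
  obtains u s where "u \<in> q" "u \<in> a" "s \<in> a" "s \<notin> q" "adj H u s"
proof -
  obtain c :: "'a \<Rightarrow> bool" where "a \<subseteq> verts H" and c: "\<forall>u\<in>a. \<forall>v\<in>a. adj H u v \<longleftrightarrow> c u \<noteq> c v"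
    "\<exists>u\<in>a. c u" "\<exists>u\<in>a. \<not> c u"
    by (rule bicliqueE[OF bicliques(2)])
  obtain x where x: "x \<in> q" "x \<in> a" using meet by blast
  obtain s where s: "s \<in> a" "s \<notin> q"
    using biclique_subset_eq[OF bicliques(2,1)] distinct by blast
  obtain z where z: "z \<in> a" "c z \<noteq> c x" using c(2,3) by metis
  show ?thesis
  proof (cases "adj H x s")
    case True
    then show ?thesis using that x s by blast
  next
    case False
    then have "adj H x z" "adj H z s" using c(1) x s z by metis+
    then show ?thesis using that x s z by blast
  qed
qed

text \<open>Let u s and v t be boundary edges of a and b. With a and b disjoint, a neighbour y of u
  in q is forced into a by the edge y s or the induced path y, u, s; likewise the neighbours of v in
  q lie in b. If u and v are adjacent, v is in a; if not, they share a side of q and a common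
  neighbour, which lies in both.\<close>

lemma neighbours_intersect: "a \<inter> b \<noteq> {}"
proof
  assume dis: "a \<inter> b = {}"
  obtain c :: "'a \<Rightarrow> bool" where "q \<subseteq> verts H" and c: "\<forall>u\<in>q. \<forall>v\<in>q. adj H u v \<longleftrightarrow> c u \<noteq> c v"
    "\<exists>u\<in>q. c u" "\<exists>u\<in>q. \<not> c u"
    by (rule bicliqueE[OF bicliques(1)])
  obtain u s where u: "u \<in> q" "u \<in> a" "s \<in> a" "s \<notin> q" "adj H u s" by (rule boundary_edge)
  obtain v t where v: "v \<in> q" "v \<in> b" "t \<in> b" "t \<notin> q" "adj H v t"
    using degree_two_biclique.boundary_edge[OF swap] by blast
  have n: "u \<notin> b" "s \<notin> b" "v \<notin> a" "t \<notin> a" using dis u v by auto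
  have au: "y \<in> a" if "y \<in> q" "adj H u y" for y
    using edge_cases[of y s] path_cases[of y u s] that u n adj_commute[of H] by blast
  have bv: "y \<in> b" if "y \<in> q" "adj H v y" for y
    using edge_cases[of y t] path_cases[of y v t] that v n adj_commute[of H] by blast
  show False
  proof (cases "adj H u v")
    case True
    then show False using au v n by blast
  next
    case False
    obtain y where "y \<in> q" "c y \<noteq> c u" using c(2,3) by metis
    then have "adj H u y" "adj H v y" using c(1) u v False by metis+
    then show False using au bv \<open>y \<in> q\<close> dis by blast
  qed
qed

section \<open>The case in which no edge escapes from a or b\<close>

definition stays :: "'a set \<Rightarrow> bool" where
  "stays B \<longleftrightarrow> (\<forall>s\<in>B - q. \<forall>t. adj H s t \<longrightarrow> t \<in> B \<union> q)"

text \<open>By \<open>edge_cases\<close> no edge leaves q \<union> a \<union> b from q, and by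
  hypothesis none from the rest, so connectedness makes this union the whole graph. A further
  biclique would avoid q and therefore be confined to a or to b, against its maximality.\<close>

lemma bicliques_if_stays:
  assumes "stays a" "stays b" and B: "biclique H B"
  shows "B = q \<or> B = a \<or> B = b"
proof (rule ccontr)
  assume nB: "\<not> ?thesis"
  then have Bq: "B \<inter> q = {}" using only[OF B] by blast
  let ?K = "q \<union> a \<union> b"
  obtain x where x: "x \<in> q" "x \<in> verts H"
    using meet bicliqueE[OF bicliques(1)] by (metis Int_emptyI subsetD)
  have step: "v \<in> ?K" if "u \<in> ?K" "adj H u v" for u v
    using that edge_cases[of u v] assms(1,2) unfolding stays_def by blast
  have "v \<in> ?K" if "(x, v) \<in> {(x, y). adj H x y}\<^sup>*" for v
    using that by induction (use x step in auto)
  then have K: "verts H \<subseteq> ?K" using connected x unfolding connected_graph_def by blast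
  obtain c :: "'a \<Rightarrow> bool" where c: "B \<subseteq> verts H" "\<forall>u\<in>B. \<forall>v\<in>B. adj H u v \<longleftrightarrow> c u \<noteq> c v"
    "\<exists>u\<in>B. c u" "\<exists>u\<in>B. \<not> c u"
    by (rule bicliqueE[OF B])
  \<comment> \<open>Any two vertices of B are joined inside B by at most two edges, and a step along
    an edge of B cannot leave A because B avoids q.\<close>
  have sub: "B \<subseteq> A" if u: "u \<in> B" "u \<in> A" and "stays A" for A u
  proof
    fix v assume v: "v \<in> B"
    obtain w where w: "w \<in> B" "c w \<noteq> c u" using c(3,4) by metis
    have stp: "x \<in> A \<Longrightarrow> x \<in> B \<Longrightarrow> y \<in> B \<Longrightarrow> c x \<noteq> c y \<Longrightarrow> y \<in> A" for x y
      using \<open>stays A\<close> c(2) Bq unfolding stays_def by blast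
    show "v \<in> A" using stp[of u w] stp[of w v] stp[of u v] u v w by blast
  qed
  obtain u where "u \<in> B" using c by blast
  then have "u \<in> a \<or> u \<in> b" using K Bq c(1) by blast
  then have "B \<subseteq> a \<or> B \<subseteq> b" using sub \<open>u \<in> B\<close> assms by blast
  then show False using nB biclique_subset_eq[OF B] bicliques by blast
qed

lemma biclique_graph_if_stays:
  assumes "stays a" "stays b"
  shows "biclique_graph (delete_vertex (KB H) q)"
proof (rule biclique_graph_K2)
  show "verts (delete_vertex (KB H) q) = {a, b}"
    using bicliques_if_stays[OF assms] bicliques distinct
    by (auto simp: verts_delete_vertex verts_KB)
qed (use bicliques distinct neighbours_intersect in \<open>auto simp: adj_delete_vertex adj_KB\<close>)

section \<open>Deleting the vertices private to q\<close>

text \<open>What remains of q after the deletion lies inside a, so q vanishes instead of shrinking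
  to a new biclique. The delicate point is that the remaining graph is connected.\<close>

lemma biclique_graph_if_subset:
  assumes ba: "q \<inter> b \<subseteq> a"
  shows "biclique_graph (delete_vertex (KB H) q)"
proof (rule biclique_graphI)
  let ?P = "q - a"
  define r where "r = adj H"
  define H' where "H' = graph_of (verts H - ?P) r"
  have rs: "r u v \<Longrightarrow> r v u" for u v unfolding r_def using adj_commute[of H] by blast
  have vH': "verts H' = verts H - ?P" by (simp add: H'_def)
  have "adj H' u v \<longleftrightarrow> u \<in> verts H - ?P \<and> v \<in> verts H - ?P \<and> r u v" for u v
    unfolding H'_def by (rule adj_graph_of[OF rs])
  then have aH': "adj H' u v \<longleftrightarrow> u \<notin> ?P \<and> v \<notin> ?P \<and> adj H u v" for u v
    unfolding r_def using simple_graph_adj(1,2)[OF simple, of u v] by blast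
  have cb: "induces_complete_bipartite H' S \<longleftrightarrow> induces_complete_bipartite H S \<and> S \<inter> ?P = {}" for S
  proof (cases "S \<inter> ?P = {}")
    case True
    then have "adj H' u v \<longleftrightarrow> adj H u v" if "u \<in> S" "v \<in> S" for u v
      using that aH' by blast
    then show ?thesis
      unfolding induces_complete_bipartite_iff_colouring using True by (simp add: vH') blast
  next
    case False
    then show ?thesis unfolding induces_complete_bipartite_def vH' by blast
  qed
  have dis: "B \<inter> ?P = {}" if "biclique H B" "B \<noteq> q" for B
    using only[OF that(1)] that(2) ba by blast
  obtain c :: "'a \<Rightarrow> bool" where "q \<subseteq> verts H" and c: "\<forall>u\<in>q. \<forall>v\<in>q. adj H u v \<longleftrightarrow> c u \<noteq> c v"
    "\<exists>u\<in>q. c u" "\<exists>u\<in>q. \<not> c u"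
    by (rule bicliqueE[OF bicliques(1)])
  have priv: "v \<in> q" if "u \<in> ?P" "adj H u v" for u v
    using edge_cases[of u v] that ba by blast
  \<comment> \<open>The endpoint u in q of a boundary edge u s of a is on the side of p. Otherwise
    p, u, s would be an induced path, as all neighbours of p are in q; but s is outside q and p is
    outside both a and b.\<close>
  have hub: "\<exists>h. h \<in> q \<and> h \<in> a \<and> c h = c p" if p: "p \<in> ?P" for p
  proof -
    obtain u s where u: "u \<in> q" "u \<in> a" "s \<in> a" "s \<notin> q" "adj H u s" by (rule boundary_edge)
    have "c u = c p"
    proof (rule ccontr)
      assume "c u \<noteq> c p"
      then have "adj H p u" using c(1) u p by auto
      then show False
        using path_cases[of p u s] priv[of p s] p u ba by blast
    qed
    then show ?thesis using u by blast
  qed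
  then obtain h where h: "\<And>p. p \<in> ?P \<Longrightarrow> h p \<in> q \<and> h p \<in> a \<and> c (h p) = c p"
    by metis
  define g where "g v = (if v \<in> ?P then h v else v)" for v
  have gP: "g v \<notin> ?P" for v using h[of v] by (simp add: g_def)
  have gq: "g v \<in> q \<and> c (g v) = c v" if "v \<in> q" for v
    using h[of v] that by (auto simp: g_def)
  \<comment> \<open>The retraction g moves the deleted vertices of q into q \<inter> a, each within its own side.\<close>
  have "connected_graph H'"
  proof (rule connected_graph_map[OF connected])
    show "(g u, g v) \<in> {(x, y). adj H' x y}\<^sup>*" if uv: "adj H u v" for u v
    proof -
      have "adj H' (g u) (g v)"
      proof (cases "u \<in> ?P \<or> v \<in> ?P")
        case True
        then have "u \<in> q" "v \<in> q" using priv uv adj_commute[of H] by blast+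
        moreover from this have "c u \<noteq> c v" using c(1) uv by blast
        ultimately have "adj H (g u) (g v)" using c(1) gq[of u] gq[of v] by metis
        then show ?thesis using gP aH' by blast
      next
        case False
        then show ?thesis using uv by (auto simp: g_def aH')
      qed
      then show ?thesis by blast
    qed
    show "\<exists>u\<in>verts H. (g u, w) \<in> {(x, y). adj H' x y}\<^sup>*" if "w \<in> verts H'" for w
      using that by (intro bexI[of _ w]) (auto simp: vH' g_def)
  qed
  moreover have "simple_graph H'" unfolding H'_def
  proof (rule simple_graph_of)
    show "finite (verts H - ?P)" using simple by (simp add: simple_graph_def)
    show "verts H - ?P \<noteq> {}" using meet bicliqueE[OF bicliques(2)] by blast
    show "\<not> r u u" for u using irrefl by (simp add: r_def)
  qed
  ultimately show "graph H'" by (simp add: graph_def)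
  show "graph_iso (delete_vertex (KB H) q) (KB H')"
  proof (rule graph_iso_KB[where f = "\<lambda>B. B" and F = "{B. biclique H B} - {q}"])
    show "induces_complete_bipartite H' B" if "B \<in> {B. biclique H B} - {q}" for B
      using that cb dis unfolding biclique_def by blast
    show "\<exists>B\<in>{B. biclique H B} - {q}. T \<subseteq> B" if T: "induces_complete_bipartite H' T" for T
    proof -
      have T': "induces_complete_bipartite H T" "T \<inter> ?P = {}" using T cb by auto
      obtain B where B: "biclique H B" "T \<subseteq> B"
        using complete_bipartite_extends[OF simple T'(1)] by blast
      show ?thesis
      proof (cases "B = q")
        case True
        then have "T \<subseteq> a" using B T'(2) by blast
        then show ?thesis using bicliques distinct by blast
      qed (use B in blast)
    qed
    show "B = C" if "B \<in> {B. biclique H B} - {q}" "C \<in> {B. biclique H B} - {q}" "B \<subseteq> C" for B C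
      using that biclique_subset_eq by blast
  qed (auto simp: verts_delete_vertex verts_KB adj_delete_vertex adj_KB)
qed

section \<open>The tripartite case\<close>

text \<open>The witnesses x1 and x2 exclude b and a as containers of a star, and the edge s t
  leaving a supplies a vertex t outside both a and q. Stars through these vertices determine all
  adjacencies of X, Y and Z.\<close>

lemma tripartite_if_not_stays:
  assumes x1: "x1 \<in> q" "x1 \<in> a" "x1 \<notin> b" and x2: "x2 \<in> q" "x2 \<in> b" "x2 \<notin> a"
    and "\<not> stays a"
  obtains X Y V Z where "X \<noteq> {}" "Y \<noteq> {}" "V \<noteq> {}" "Z \<noteq> {}"
    "q = X \<union> Y" "a = X \<union> V \<union> Z" "b = Y \<union> V \<union> Z"
    "X \<inter> Y = {}" "(X \<union> Y) \<inter> V = {}" "(X \<union> Y \<union> V) \<inter> Z = {}"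
    "\<And>x u. x \<in> X \<Longrightarrow> adj H x u \<longleftrightarrow> u \<in> Y \<union> Z"
    "\<And>y u. y \<in> Y \<Longrightarrow> adj H y u \<longleftrightarrow> u \<in> X \<union> Z"
    "\<And>z u. z \<in> Z \<Longrightarrow> adj H z u \<longleftrightarrow> u \<in> X \<union> Y \<union> V"
    "\<And>v w. v \<in> V \<Longrightarrow> w \<in> V \<Longrightarrow> \<not> adj H v w"
proof -
  note sym = adj_commute[of H]
  obtain s t where s: "s \<in> a" "s \<notin> q" and st: "adj H s t" and t: "t \<notin> a" "t \<notin> q"
    using \<open>\<not> stays a\<close> unfolding stays_def by blast
  obtain ca :: "'a \<Rightarrow> bool" where "a \<subseteq> verts H" and ca: "\<forall>u\<in>a. \<forall>v\<in>a. adj H u v \<longleftrightarrow> ca u \<noteq> ca v"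
    "\<exists>u\<in>a. ca u" "\<exists>u\<in>a. \<not> ca u"
    by (rule bicliqueE[OF bicliques(2)])
  obtain cb :: "'a \<Rightarrow> bool" where "b \<subseteq> verts H" and cb: "\<forall>u\<in>b. \<forall>v\<in>b. adj H u v \<longleftrightarrow> cb u \<noteq> cb v"
    "\<exists>u\<in>b. cb u" "\<exists>u\<in>b. \<not> cb u"
    by (rule bicliqueE[OF bicliques(3)])
  obtain cq :: "'a \<Rightarrow> bool" where "q \<subseteq> verts H" and cq: "\<forall>u\<in>q. \<forall>v\<in>q. adj H u v \<longleftrightarrow> cq u \<noteq> cq v"
    "\<exists>u\<in>q. cq u" "\<exists>u\<in>q. \<not> cq u"
    by (rule bicliqueE[OF bicliques(1)])
  have out_a: "u \<in> a \<and> v \<in> a" if "adj H u v" "u \<in> q" "u \<notin> b" "v \<notin> q" for u v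
    using edge_cases[of u v] that by blast
  have out_b: "u \<in> b \<and> v \<in> b" if "adj H u v" "u \<in> q" "u \<notin> a" "v \<notin> q" for u v
    using edge_cases[of u v] that by blast
  have tx1: "\<not> adj H t x1" using out_a[of x1 t] t x1 sym[of t x1] by blast
  \<comment> \<open>Otherwise t, s, w would be an induced path with t outside q and a, and w outside
    b.\<close>
  have 1: "\<not> adj H s w" if w: "w \<in> q" "w \<notin> b" for w
    using out_a[of w t] path_cases[of t s w] sym[of t s] sym[of w t] st s t w by blast
  \<comment> \<open>This keeps q \<inter> a on the side of x1, whence Y avoids a and Z avoids q. A
    counterexample y is forced into b together with s. If x2 is adjacent to y, there is a claw at y
    with leaves x1, x2, s; if not, x1, x2, s is an induced path. In both s is outside q, x2 outside
    a and x1 outside b.\<close>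
  have 2: "\<not> adj H y x1" if y: "y \<in> q" "y \<in> a" for y
  proof
    assume yx1: "adj H y x1"
    have ys: "adj H y s" "\<not> adj H s x1" using 1[OF x1(1,3)] yx1 ca(1) y s x1 by blast+
    then have yb: "y \<in> b" using 1[OF y(1)] sym[of y s] by blast
    have "\<not> adj H t y" using path_cases[of t y x1] t tx1 yx1 x1 by blast
    then have sb: "s \<in> b" using path_cases[of t s y] t st sym[of t s] sym[of s y] ys y by blast
    show False
    proof (cases "adj H x2 y")
      case True
      then have "\<not> adj H x2 s" using cb(1) sb yb x2 ys by blast
      moreover have "\<not> adj H x1 x2" using cq(1) True yx1 x1 x2 y by blast
      moreover have "\<not> adj H x1 s" using ys(2) sym[of x1 s] by blast
      ultimately have "{y, x1, x2, s} \<subseteq> q \<or> {y, x1, x2, s} \<subseteq> a \<or> {y, x1, x2, s} \<subseteq> b"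
        using claw_cases[of x1 y x2 s] True yx1 ys(1) sym[of x1 y] sym[of y s] y by blast
      then show False using s x1 x2 by blast
    next
      case False
      then have "adj H x2 s" using cb(1) sb yb x2 ys by blast
      moreover have "adj H x1 x2" using cq(1) False yx1 x1 x2 y by blast
      ultimately show False
        using path_cases[of x1 x2 s] ys(2) sym[of x1 s] s x1 x2 by blast
    qed
  qed
  \<comment> \<open>All classes are read off from x1: X and Y are its own and the opposite side of
    q, Z is the opposite side of a, and V is the part of its own side of a that lies outside
    q.\<close>
  define X where "X = {x \<in> q. \<not> adj H x x1}"
  define Y where "Y = {y \<in> q. adj H y x1}"
  define Z where "Z = {z \<in> a. adj H z x1}"
  define V where "V = {v \<in> a. v \<notin> q \<and> \<not> adj H v x1}"
  have X1: "x1 \<in> X" using x1 irrefl by (simp add: X_def)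
  obtain y1 where y1: "y1 \<in> Y" using cq x1(1) unfolding Y_def by (metis (mono_tags, lifting) mem_Collect_eq)
  obtain z1 where z1: "z1 \<in> Z" using ca x1(2) unfolding Z_def by (metis (mono_tags, lifting) mem_Collect_eq)
  have sV: "s \<in> V" using s 1[OF x1(1,3)] by (simp add: V_def)
  have Zq: "z \<notin> q" if "z \<in> Z" for z using 2 that by (auto simp: Z_def)
  have Ya: "y \<notin> a" if "y \<in> Y" for y using 2 that by (auto simp: Y_def)
  have ZY: "adj H z y" if "z \<in> Z" "y \<in> Y" for z y
    using path_cases[of z x1 y] Zq[of z] Ya[of y] that x1 sym[of x1 y] unfolding Z_def Y_def by blast
  have ZYb: "z \<in> b \<and> y \<in> b" if "z \<in> Z" "y \<in> Y" for z y
    using out_b[of y z] ZY[OF that] Zq[of z] Ya[of y] that sym[of y z] unfolding Y_def by blast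
  have VZ: "adj H v z" if "v \<in> V" "z \<in> Z" for v z
    using ca(1) that x1(2) unfolding V_def Z_def by blast
  \<comment> \<open>An edge v y would put v into b, where v, y, z1 would form a triangle.\<close>
  have VY: "\<not> adj H v y" if "v \<in> V" "y \<in> Y" for v y
  proof
    assume vy: "adj H v y"
    have "v \<in> b" using out_b[of y v] vy sym[of y v] that Ya[of y] unfolding V_def Y_def by blast
    then show False
      using cb(1) vy ZYb[OF z1 that(2)] ZY[OF z1 that(2)] VZ[OF that(1) z1] by blast
  qed
  have Vb: "v \<in> b" if "v \<in> V" for v
    using path_cases[of v z1 y1] VY[OF that y1] VZ[OF that z1] ZY[OF z1 y1] y1 Ya[OF y1] Zq[OF z1]
    unfolding Y_def by blast
  have XY: "adj H x y" if "x \<in> X" "y \<in> Y" for x y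
    using cq(1) that x1(1) unfolding X_def Y_def by blast
  \<comment> \<open>If x were in b, the edge x y1 would make it nonadjacent to z1 and so keep it out
    of a. Then s is adjacent to x, which draws t into b and makes t adjacent to y1; the induced path
    t, y1, x1 fits in none of q, a, b.\<close>
  have Xb: "x \<notin> b" if x: "x \<in> X" for x
  proof
    assume xb: "x \<in> b"
    have xq: "x \<in> q" using x by (simp add: X_def)
    have xz: "\<not> adj H x z1"
      using cb(1) xb XY[OF x y1] ZY[OF z1 y1] ZYb[OF z1 y1] by blast
    then have xa: "x \<notin> a" using ca(1) x z1 x1 unfolding X_def Z_def by blast
    have sx: "adj H s x" using cb(1) xb xz ZYb[OF z1 y1] VZ[OF sV z1] Vb[OF sV] by blast
    have tb: "t \<in> b"
      using out_b[of x t] path_cases[of t s x] sym[of t s] sym[of t x] st sx xq xa s t by blast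
    have "adj H t y1"
      using cb(1) tb Vb[OF sV] st VZ[OF sV z1] ZY[OF z1 y1] ZYb[OF z1 y1] by blast
    then show False
      using path_cases[of t y1 x1] tx1 y1 x1 t Ya[OF y1] unfolding Y_def by blast
  qed
  have Xa: "x \<in> a \<and> adj H z x" if x: "x \<in> X" and z: "z \<in> Z" for x z
  proof -
    have "adj H z x"
      using path_cases[of z y1 x] ZY[OF z y1] XY[OF x y1] sym[of y1 x] Zq[OF z] Ya[OF y1] Xb[OF x] y1
      unfolding Y_def by blast
    then show ?thesis
      using out_a[of x z] sym[of x z] Zq[OF z] Xb[OF x] x unfolding X_def by blast
  qed
  \<comment> \<open>If u is not adjacent to x1, it is adjacent to an end of the edge z1 y1 of b. The
    induced path from u through that end to x1 is not inside q because of u, nor inside b because of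
    x1.\<close>
  have ba: "u \<in> a" if u: "u \<in> b" "u \<notin> q" for u
  proof (cases "adj H u x1")
    case True
    then show ?thesis using out_a[of x1 u] x1 u sym[of x1 u] by blast
  next
    case False
    have "adj H u z1 \<or> adj H u y1"
      using cb(1) u ZYb[OF z1 y1] ZY[OF z1 y1] by blast
    then show ?thesis
      using path_cases[of u z1 x1] path_cases[of u y1 x1] False x1 u Ya[OF y1] y1 z1
      unfolding Y_def Z_def by blast
  qed
  show thesis
  proof (rule that[of X Y V Z])
    show "X \<noteq> {}" "Y \<noteq> {}" "V \<noteq> {}" "Z \<noteq> {}" using X1 y1 z1 sV by auto
    show qXY: "q = X \<union> Y" unfolding X_def Y_def by blast
    have aVZ: "u \<in> V \<union> Z" if "u \<in> a" "u \<notin> q" for u using that unfolding V_def Z_def by blast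
    show aX: "a = X \<union> V \<union> Z"
      using aVZ Xa z1 qXY Ya by (auto simp: V_def Z_def)
    show bY: "b = Y \<union> V \<union> Z"
      using aVZ ba Xb qXY Vb ZYb y1 z1 by blast
    show "X \<inter> Y = {}" "(X \<union> Y) \<inter> V = {}" "(X \<union> Y \<union> V) \<inter> Z = {}"
      using Zq unfolding X_def Y_def V_def Z_def by auto
    have XX: "\<not> adj H x u" if "x \<in> X" "u \<in> X" for x u
      using cq(1) that x1(1) unfolding X_def by blast
    have YYn: "\<not> adj H x u" if "x \<in> Y" "u \<in> Y" for x u
      using cq(1) that x1(1) unfolding Y_def by blast
    have XV: "\<not> adj H x u" if "x \<in> X" "u \<in> V" for x u
      using ca(1) that x1(2) Xa[OF that(1) z1] unfolding X_def V_def by blast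
    show "adj H x u \<longleftrightarrow> u \<in> Y \<union> Z" if x: "x \<in> X" for x u
    proof
      assume xu: "adj H x u"
      show "u \<in> Y \<union> Z"
      proof (cases "u \<in> q")
        case True
        then show ?thesis using XX[OF x] xu qXY by blast
      next
        case False
        then have "u \<in> a" using out_a[OF xu] x Xb[OF x] qXY by blast
        then show ?thesis using aVZ[of u] False XV[OF x] xu by blast
      qed
    qed (use x XY Xa sym in blast)
    show "adj H y u \<longleftrightarrow> u \<in> X \<union> Z" if y: "y \<in> Y" for y u
    proof
      assume yu: "adj H y u"
      show "u \<in> X \<union> Z"
      proof (cases "u \<in> q")
        case True
        then show ?thesis using YYn[OF y] yu qXY by blast
      next
        case False
        then have "u \<in> a" using out_b[OF yu] y Ya[OF y] qXY ba by blast
        then show ?thesis using aVZ[of u] False VY[of u y] y yu sym[of u y] by blast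
      qed
    qed (use y XY ZY sym in blast)
    show "adj H z u \<longleftrightarrow> u \<in> X \<union> Y \<union> V" if z: "z \<in> Z" for z u
    proof
      assume zu: "adj H z u"
      show "u \<in> X \<union> Y \<union> V"
      proof (cases "u \<in> q")
        case False
        have z': "z \<in> a" "adj H z x1" using z by (auto simp: Z_def)
        \<comment> \<open>Otherwise u would be in a and close a triangle with z and x1 there. Hence
          u, z, x1 is an induced path, which only a can contain.\<close>
        have ux1: "\<not> adj H u x1"
        proof
          assume ux1: "adj H u x1"
          then have "u \<in> a" using out_a[of x1 u] False x1 sym[of x1 u] by blast
          then show False using ca(1) ux1 z' zu x1(2) by metis
        qed
        then have "u \<in> a" using path_cases[of u z x1] z' zu sym[of u z] x1 False by blast
        then show ?thesis using False ux1 unfolding V_def by blast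
      qed (use qXY in blast)
    qed (use z Xa ZY VZ sym in blast)
    show "\<not> adj H v w" if "v \<in> V" "w \<in> V" for v w
      using ca(1) that x1(2) unfolding V_def by blast
  qed
qed

lemma biclique_graph_if_tripartite:
  assumes ne: "X \<noteq> {}" "Y \<noteq> {}" "V \<noteq> {}" "Z \<noteq> {}"
    and parts: "q = X \<union> Y" "a = X \<union> V \<union> Z" "b = Y \<union> V \<union> Z"
    and disj: "X \<inter> Y = {}" "(X \<union> Y) \<inter> V = {}" "(X \<union> Y \<union> V) \<inter> Z = {}"
    and X: "\<And>x u. x \<in> X \<Longrightarrow> adj H x u \<longleftrightarrow> u \<in> Y \<union> Z"
    and Y: "\<And>y u. y \<in> Y \<Longrightarrow> adj H y u \<longleftrightarrow> u \<in> X \<union> Z"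
    and Z: "\<And>z u. z \<in> Z \<Longrightarrow> adj H z u \<longleftrightarrow> u \<in> X \<union> Y \<union> V"
    and V: "\<And>v w. v \<in> V \<Longrightarrow> w \<in> V \<Longrightarrow> \<not> adj H v w"
  shows "biclique_graph (delete_vertex (KB H) q)"
proof (rule biclique_graphI)
  let ?F = "{B. biclique H B} - {q}"
  \<comment> \<open>The new vertex None keeps the images of a and b maximal even if some vertex outside them
    is adjacent to all of V.\<close>
  define r where "r m n = (case (m, n) of
      (Some u, Some v) \<Rightarrow> adj H u v \<and> u \<notin> Y \<and> v \<notin> Y \<or> u \<in> Y \<and> v \<in> V \<or> v \<in> Y \<and> u \<in> V
    | (None, Some v) \<Rightarrow> v \<in> Y \<union> Z
    | (Some u, None) \<Rightarrow> u \<in> Y \<union> Z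
    | (None, None) \<Rightarrow> False)" for m n
  define K where "K = graph_of (insert None (Some ` verts H)) r"
  have rs: "r m n \<Longrightarrow> r n m" for m n
    unfolding r_def by (auto split: option.splits simp: adj_commute[of H])
  have vK: "verts K = insert None (Some ` verts H)" by (simp add: K_def)
  have aK: "adj K m n \<longleftrightarrow> m \<in> verts K \<and> n \<in> verts K \<and> r m n" for m n
    unfolding vK unfolding K_def by (rule adj_graph_of[OF rs])
  have sub: "X \<subseteq> verts H" "Y \<subseteq> verts H" "V \<subseteq> verts H" "Z \<subseteq> verts H"
    using parts bicliqueE[OF bicliques(2)] bicliqueE[OF bicliques(3)] by (metis Un_subset_iff)+
  have SK: "Some u \<in> verts K \<longleftrightarrow> u \<in> verts H" for u by (auto simp: vK)
  have NK: "None \<in> verts K" by (simp add: vK)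
  have aO: "adj K (Some u) (Some v) \<longleftrightarrow> adj H u v" if "u \<notin> Y" "v \<notin> Y" for u v
    using that simple_graph_adj(1,2)[OF simple, of u v] by (auto simp: aK SK r_def)
  have aY: "adj K (Some y) (Some v) \<longleftrightarrow> v \<in> V" if "y \<in> Y" for y v
    using that disj sub by (auto simp: aK SK r_def)
  have aY': "adj K (Some v) (Some y) \<longleftrightarrow> v \<in> V" if "y \<in> Y" for y v
    using aY[OF that] adj_commute[of K] by blast
  have aN: "adj K None (Some v) \<longleftrightarrow> v \<in> Y \<union> Z" "adj K (Some v) None \<longleftrightarrow> v \<in> Y \<union> Z"
    "\<not> adj K None None" for v
    using sub by (auto simp: aK SK NK r_def)
  have aX: "adj K (Some x) (Some v) \<longleftrightarrow> v \<in> Z" if "x \<in> X" for x v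
    using that aO[of x v] aY'[of v x] X[of x v] disj by (cases "v \<in> Y") blast+
  have aZ: "adj K (Some z) (Some v) \<longleftrightarrow> v \<in> X \<union> V" if "z \<in> Z" for z v
    using that aO[of z v] aY'[of v z] Z[of z v] disj by (cases "v \<in> Y") blast+
  \<comment> \<open>A biclique through Z that avoids q has only vertices of V opposite Z, so Y can
    join the side of Z. The image of a must not gain Y, since Y is not adjacent to Z in K; b
    contains Y anyway.\<close>
  define f where "f B = Some ` B \<union> (if B = a \<or> B = b then {None} else {}) \<union>
    (if B \<noteq> a \<and> B \<inter> Z \<noteq> {} then Some ` Y else {})" for B
  have fa: "f a = insert None (Some ` a)" by (auto simp: f_def)
  have fb: "f b = insert None (Some ` b)" using parts by (auto simp: f_def)
  have fa': "f a = insert None (Some ` (X \<union> V \<union> Z))" unfolding fa by (simp add: parts(2))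
  have fb': "f b = insert None (Some ` (Y \<union> V \<union> Z))" unfolding fb by (simp add: parts(3))
  have Bq: "B \<inter> X = {}" "B \<inter> Y = {}" if "B \<in> ?F" "B \<noteq> a" "B \<noteq> b" for B
    using only[of B] that parts by auto
  have SfB: "Some u \<in> f B \<longleftrightarrow> u \<in> B \<or> B \<noteq> a \<and> B \<inter> Z \<noteq> {} \<and> u \<in> Y" for u B
    by (auto simp: f_def)
  have NfB: "None \<in> f B \<longleftrightarrow> B = a \<or> B = b" for B by (auto simp: f_def)
  \<comment> \<open>All vertices of Z have the same neighbours, so by maximality a biclique
    containing one contains all. This will provide a common vertex of B and C whenever their images
    meet in Y.\<close>
  have twin: "Z \<subseteq> B" if B: "B \<in> ?F" and z: "z \<in> B" "z \<in> Z" for B z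
  proof -
    have B': "biclique H B" using B by simp
    obtain c :: "'a \<Rightarrow> bool" where c: "B \<subseteq> verts H" "\<forall>u\<in>B. \<forall>v\<in>B. adj H u v \<longleftrightarrow> c u \<noteq> c v"
      "\<exists>u\<in>B. c u" "\<exists>u\<in>B. \<not> c u"
      by (rule bicliqueE[OF B'])
    have k: "adj H u z' \<longleftrightarrow> c u \<noteq> c z" if "u \<in> B" "z' \<in> Z" for u z'
      using c(2) that z Z adj_commute[of H u] by metis
    have Zc: "c u = c z" if "u \<in> B" "u \<in> Z" for u using k[OF that] irrefl by blast
    have "induces_complete_bipartite H (B \<union> Z)"
    proof (rule complete_bipartiteI[where c = "\<lambda>u. u \<in> Z \<or> c u = c z"])
      show "B \<union> Z \<subseteq> verts H" using c sub by blast
      show "\<exists>u\<in>B \<union> Z. \<not> (u \<in> Z \<or> c u = c z)" using c(3,4) Zc by (metis UnI1)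
      have ZZ: "\<not> adj H u v" if "u \<in> Z" "v \<in> Z" for u v using Z[of u v] that disj by blast
      show "adj H u v \<longleftrightarrow> (u \<in> Z \<or> c u = c z) \<noteq> (v \<in> Z \<or> c v = c z)"
        if uv: "u \<in> B \<union> Z" "v \<in> B \<union> Z" for u v
      proof (cases "u \<in> Z"; cases "v \<in> Z")
        assume "u \<notin> Z" "v \<notin> Z"
        then have "u \<in> B" "v \<in> B" using uv by auto
        then have "adj H u v \<longleftrightarrow> c u \<noteq> c v" using c(2) by blast
        then show ?thesis using \<open>u \<notin> Z\<close> \<open>v \<notin> Z\<close> by auto
      next
        assume "u \<in> Z" "v \<notin> Z"
        then have "adj H v u \<longleftrightarrow> c v \<noteq> c z" using k uv by blast
        then show ?thesis using \<open>u \<in> Z\<close> \<open>v \<notin> Z\<close> adj_commute[of H u v] by auto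
      next
        assume "u \<notin> Z" "v \<in> Z"
        then have "adj H u v \<longleftrightarrow> c u \<noteq> c z" using k uv by blast
        then show ?thesis using \<open>u \<notin> Z\<close> \<open>v \<in> Z\<close> by auto
      qed (use ZZ in auto)
    qed (use z in auto)
    then show ?thesis using biclique_maximal[OF B'] by blast
  qed
  have cb: "induces_complete_bipartite K (f B)" if B: "B \<in> ?F" for B
  proof -
    have fK: "f B \<subseteq> verts K"
      using biclique_subset_verts[of H B] B sub by (auto simp: f_def vK split: if_splits)
    consider "B = a" | "B = b" | "B \<noteq> a" "B \<noteq> b" by blast
    then show ?thesis
    proof cases
      case 1
      have "induces_complete_bipartite K (f a)"
      proof (rule complete_bipartiteI[where c = "\<lambda>w. w \<in> Some ` Z"])
        show "adj K m n \<longleftrightarrow> (m \<in> Some ` Z) \<noteq> (n \<in> Some ` Z)" if "m \<in> f a" "n \<in> f a" for m n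
        proof -
          have 1: "adj K (Some z) n \<longleftrightarrow> n \<notin> Some ` Z" if "z \<in> Z" "n \<in> f a" for z n
            using that aZ[OF that(1)] aN(2)[of z] disj unfolding fa' by auto
          have 2: "\<not> adj K m n" if "m \<in> f a" "n \<in> f a" "m \<notin> Some ` Z" "n \<notin> Some ` Z"
          proof -
            have "m = None \<or> (\<exists>u\<in>X. m = Some u) \<or> (\<exists>u\<in>V. m = Some u)"
              "n = None \<or> (\<exists>u\<in>X. n = Some u) \<or> (\<exists>u\<in>V. n = Some u)"
              using that unfolding fa' by blast+
            moreover have "\<not> adj K (Some u) (Some v)" if "u \<in> X" "v \<in> X \<union> V" for u v
              using aX[OF that(1)] that disj by blast
            moreover have "\<not> adj K (Some u) (Some v)" if "u \<in> V" "v \<in> V" for u v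
              using aO[of u v] V[OF that] that disj by blast
            moreover have "u \<notin> Y \<union> Z" if "u \<in> X \<union> V" for u using that disj by blast
            ultimately show ?thesis using aN adj_commute[of K m n] by blast
          qed
          show ?thesis
            using 1 2 that adj_commute[of K m n] by blast
        qed
      qed (use fK ne fa' 1 in auto)
      then show ?thesis using 1 by simp
    next
      case 2
      have "induces_complete_bipartite K (f b)"
      proof (rule complete_bipartiteI[where c = "\<lambda>w. w \<in> Some ` (Y \<union> Z)"])
        show "adj K m n \<longleftrightarrow> (m \<in> Some ` (Y \<union> Z)) \<noteq> (n \<in> Some ` (Y \<union> Z))"
          if "m \<in> f b" "n \<in> f b" for m n
        proof -
          have 1: "adj K (Some w) n \<longleftrightarrow> n \<notin> Some ` (Y \<union> Z)" if "w \<in> Y \<union> Z" "n \<in> f b" for w n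
            using that aZ[of w] aY[of w] aN(2)[of w] disj unfolding fb' by auto
          have 2: "\<not> adj K m n" if "m \<in> f b" "n \<in> f b" "m \<notin> Some ` (Y \<union> Z)" "n \<notin> Some ` (Y \<union> Z)"
          proof -
            have "m = None \<or> (\<exists>u\<in>V. m = Some u)" "n = None \<or> (\<exists>u\<in>V. n = Some u)"
              using that unfolding fb' by blast+
            moreover have "\<not> adj K (Some u) (Some v)" if "u \<in> V" "v \<in> V" for u v
              using aO[of u v] V[OF that] that disj by blast
            moreover have "u \<notin> Y \<union> Z" if "u \<in> V" for u using that disj by blast
            ultimately show ?thesis using aN by blast
          qed
          show ?thesis
            using 1 2 that adj_commute[of K m n] by blast
        qed
      qed (use fK ne fb' 2 in auto)
      then show ?thesis using 2 by simp
    next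
      case 3
      have B': "biclique H B" using B by simp
      note BXY = Bq[OF B 3]
      obtain c :: "'a \<Rightarrow> bool" where c: "B \<subseteq> verts H" "\<forall>u\<in>B. \<forall>v\<in>B. adj H u v \<longleftrightarrow> c u \<noteq> c v"
        "\<exists>u\<in>B. c u" "\<exists>u\<in>B. \<not> c u"
        by (rule bicliqueE[OF B'])
      show ?thesis
      proof (cases "B \<inter> Z = {}")
        case True
        then have fB: "f B = Some ` B" using 3 by (simp add: f_def)
        show ?thesis
        proof (rule complete_bipartiteI[where c = "\<lambda>m. c (the m)"])
          show "adj K m n \<longleftrightarrow> c (the m) \<noteq> c (the n)" if mn: "m \<in> f B" "n \<in> f B" for m n
          proof -
            obtain u v where uv: "m = Some u" "n = Some v" "u \<in> B" "v \<in> B" using mn fB by auto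
            then have "adj K m n \<longleftrightarrow> adj H u v" using aO[of u v] BXY by blast
            then show ?thesis using c(2) uv by simp
          qed
        qed (use fK c fB in auto)
      next
        case False
        then obtain z where z: "z \<in> B" "z \<in> Z" by blast
        have fB: "f B = Some ` (B \<union> Y)" using 3 False by (auto simp: f_def)
        \<comment> \<open>B avoids X and Y, so the neighbours of z in B are its vertices in V;
          membership in V therefore still separates the sides once Y is added.\<close>
        have BV: "c u \<noteq> c z \<longleftrightarrow> u \<in> V" if "u \<in> B" for u
          using c(2) z Z[OF z(2), of u] that BXY by blast
        show ?thesis
        proof (rule complete_bipartiteI[where c = "\<lambda>m. the m \<notin> V"])
          show "adj K m n \<longleftrightarrow> (the m \<notin> V) \<noteq> (the n \<notin> V)" if mn: "m \<in> f B" "n \<in> f B" for m n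
          proof -
            obtain u v where uv: "m = Some u" "n = Some v" "u \<in> B \<union> Y" "v \<in> B \<union> Y"
              using mn fB by auto
            show ?thesis
            proof (cases "u \<in> Y"; cases "v \<in> Y")
              assume "u \<notin> Y" "v \<notin> Y"
              then have "adj K m n \<longleftrightarrow> c u \<noteq> c v" "u \<in> B" "v \<in> B" using aO c(2) uv by auto
              then show ?thesis using BV[of u] BV[of v] uv by auto
            qed (use uv aY aY' disj in auto)
          qed
          obtain u where "u \<in> B" "c u \<noteq> c z" using c(3,4) by metis
          then show "\<exists>m\<in>f B. \<not> the m \<notin> V" using BV fB by auto
          show "\<exists>m\<in>f B. the m \<notin> V" using fB z disj by auto
        qed (rule fK)
      qed
    qed
  qed
  have cover: "\<exists>B\<in>?F. T \<subseteq> f B" if T: "induces_complete_bipartite K T" for T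
  proof -
    obtain c :: "'a option \<Rightarrow> bool" where c: "T \<subseteq> verts K"
      "\<forall>m\<in>T. \<forall>n\<in>T. adj K m n \<longleftrightarrow> c m \<noteq> c n" "\<exists>m\<in>T. c m" "\<exists>m\<in>T. \<not> c m"
      by (rule complete_bipartiteE[OF T])
    have aF: "a \<in> ?F" and bF: "b \<in> ?F" using bicliques distinct by auto
    have opposite: "\<exists>n\<in>T. c n \<noteq> c m" for m using c(3,4) by metis
    have inZ: "n \<in> f a" if n: "n \<in> T" "c n = c m" and m: "m \<in> T" "\<And>k. k \<in> T \<Longrightarrow> c k \<noteq> c m \<Longrightarrow> k \<in> Some ` Z" for m n
    proof -
      obtain k where k: "k \<in> T" "c k \<noteq> c m" using opposite by blast
      then obtain z where "k = Some z" "z \<in> Z" using m by blast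
      then have "adj K (Some z) n" using c(2) n k by auto
      then show ?thesis using aZ[OF \<open>z \<in> Z\<close>] fa' by (cases n) auto
    qed
    \<comment> \<open>In K a vertex of Z sees only X, V and \<open>None\<close>, so a set T with one
      side inside Z fits into the image of a.\<close>
    have inA: "T \<subseteq> f a" if m: "m \<in> T" "\<And>k. k \<in> T \<Longrightarrow> c k \<noteq> c m \<Longrightarrow> k \<in> Some ` Z" for m
    proof
      fix n assume n: "n \<in> T"
      show "n \<in> f a"
        using inZ[OF n _ m] m(2)[OF n] fa' by (cases "c n = c m") auto
    qed
    consider x where "x \<in> X" "Some x \<in> T" | "None \<in> T" | "None \<notin> T" "\<And>x. x \<in> X \<Longrightarrow> Some x \<notin> T"
      by blast
    then show ?thesis
    proof cases
      case 1
      have "k \<in> Some ` Z" if k: "k \<in> T" "c k \<noteq> c (Some x)" for k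
      proof -
        have "adj K (Some x) k" using c(2) k 1 by auto
        then show ?thesis using aX[OF 1(1)] aN(2)[of x] 1(1) disj by (cases k) auto
      qed
      then show ?thesis using inA[OF 1(2)] aF by blast
    next
      case 2
      have YZ: "k \<in> Some ` (Y \<union> Z)" if k: "k \<in> T" "c k \<noteq> c None" for k
      proof -
        have "adj K None k" using c(2) k 2 by auto
        then show ?thesis using aN by (cases k) auto
      qed
      show ?thesis
      proof (cases "\<exists>y\<in>Y. Some y \<in> T \<and> c (Some y) \<noteq> c None")
        case True
        then obtain y where y: "y \<in> Y" "Some y \<in> T" "c (Some y) \<noteq> c None" by blast
        have "n \<in> f b" if n: "n \<in> T" for n
        proof (cases "c n = c None")
          case True
          then have "adj K (Some y) n" using c(2) n y by auto
          then show ?thesis using aY[OF y(1)] fb' by (cases n) auto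
        next
          case False
          then show ?thesis using YZ[OF n] fb' by auto
        qed
        then show ?thesis using bF by blast
      next
        case False
        then have "k \<in> Some ` Z" if "k \<in> T" "c k \<noteq> c None" for k
          using YZ[OF that] that by blast
        then show ?thesis using inA[OF 2] aF by blast
      qed
    next
      case 3
      define S where "S = {u. Some u \<in> T}"
      have TS: "T = Some ` S"
      proof
        show "T \<subseteq> Some ` S"
        proof
          fix m assume "m \<in> T"
          then show "m \<in> Some ` S" using 3(1) by (cases m) (auto simp: S_def)
        qed
      qed (auto simp: S_def)
      have SX: "S \<inter> X = {}" using 3(2) by (auto simp: S_def)
      have SV: "S \<subseteq> verts H" using c(1) SK by (auto simp: S_def)
      have cS: "adj K (Some u) (Some v) \<longleftrightarrow> c (Some u) \<noteq> c (Some v)" if "u \<in> S" "v \<in> S" for u v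
        using c(2) that by (auto simp: S_def)
      have oppS: "\<exists>v\<in>S. c (Some v) \<noteq> c m" for m using opposite[of m] TS by auto
      \<comment> \<open>Y does not see V in H, so the vertices of Y in T are traded for Z, which
        sees V in both graphs. The biclique of H found above S' then meets Z, and f puts Y
        back.\<close>
      define S' where "S' = (S - Y) \<union> (if S \<inter> Y = {} then {} else Z)"
      have "induces_complete_bipartite H S'"
      proof (cases "S \<inter> Y = {}")
        case True
        then have "S' = S" by (auto simp: S'_def)
        moreover have "induces_complete_bipartite H S"
        proof (rule complete_bipartiteI[where c = "c \<circ> Some"])
          show "adj H u v \<longleftrightarrow> (c \<circ> Some) u \<noteq> (c \<circ> Some) v" if "u \<in> S" "v \<in> S" for u v
            using cS[OF that] aO[of u v] that True by auto
        qed (use SV c TS in auto)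
        ultimately show ?thesis by simp
      next
        case False
        then obtain y where y: "y \<in> S" "y \<in> Y" by blast
        have S': "S' = (S - Y) \<union> Z" using False by (simp add: S'_def)
        have cV: "c (Some u) \<noteq> c (Some y) \<longleftrightarrow> u \<in> V" if "u \<in> S" for u
          using cS[OF y(1) that] aY[OF y(2), of u] by auto
        show ?thesis
        proof (rule complete_bipartiteI[where c = "\<lambda>u. u \<notin> V"])
          show "S' \<subseteq> verts H" using SV sub S' by blast
          show "adj H u v \<longleftrightarrow> (u \<notin> V) \<noteq> (v \<notin> V)" if uv: "u \<in> S'" "v \<in> S'" for u v
          proof -
            have n: "u \<notin> X \<union> Y" "v \<notin> X \<union> Y" using uv SX disj S' by blast+
            show ?thesis
            proof (cases "u \<in> Z")
              case True
              then show ?thesis using Z[OF True, of v] n disj by blast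
            next
              case u: False
              show ?thesis
              proof (cases "v \<in> Z")
                case True
                then show ?thesis using Z[OF True, of u] n disj adj_commute[of H u v] by blast
              next
                case False
                then have "u \<in> S" "v \<in> S" using u uv S' by auto
                then show ?thesis using cS[of u v] aO[of u v] cV[of u] cV[of v] n by auto
              qed
            qed
          qed
          show "\<exists>u\<in>S'. u \<notin> V" using ne disj S' by blast
          obtain u where "u \<in> S" "c (Some u) \<noteq> c (Some y)" using oppS by blast
          then show "\<exists>u\<in>S'. \<not> u \<notin> V" using cV S' disj by blast
        qed
      qed
      then obtain B where B: "biclique H B" "S' \<subseteq> B"
        using complete_bipartite_extends[OF simple] by blast
      have S'q: "S' \<inter> q = {}" using SX disj parts by (auto simp: S'_def)
      have "S' \<noteq> {}"
        using \<open>induces_complete_bipartite H S'\<close> unfolding induces_complete_bipartite_def by blast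
      then have "B \<in> ?F" using S'q B by blast
      have SS': "S \<subseteq> S' \<union> Y" by (auto simp: S'_def)
      show ?thesis
      \<comment> \<open>S' misses q, so inside either a or b it is contained in V \<union> Z; thus
        the image of b covers T in both cases.\<close>
      proof (cases "B = a \<or> B = b")
        case True
        then have "S \<subseteq> b" using S'q B SS' parts by blast
        then show ?thesis using fb TS bF by blast
      next
        case False
        have "B \<inter> Z \<noteq> {}" if "S \<inter> Y \<noteq> {}"
          using that B ne by (auto simp: S'_def)
        then have "Some u \<in> f B" if "u \<in> S" for u
          using that False SS' B(2) SfB[of u B] by blast
        then have "T \<subseteq> f B" using TS by blast
        then show ?thesis using \<open>B \<in> ?F\<close> by blast
      qed
    qed
  qed
  show "graph_iso (delete_vertex (KB H) q) (KB K)"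
  proof (rule graph_iso_KB[where f = f and F = ?F, OF _ _ cb cover])
    show "B = C" if BC: "B \<in> ?F" "C \<in> ?F" "f B \<subseteq> f C" for B C
    proof -
      have 1: "B \<subseteq> C \<union> Y"
      proof
        fix u assume "u \<in> B"
        then have "Some u \<in> f C" using BC(3) SfB[of u B] by blast
        then show "u \<in> C \<union> Y" using SfB[of u C] by blast
      qed
      \<comment> \<open>Only b among the bicliques in question meets Y, so b is the only one whose
        inclusion could be blurred by the added Y. \<open>None\<close> limits C to a and b, and a
        vertex of Y then rules out a.\<close>
      have 2: "C = a \<or> C = b" if "B = b"
        using that BC(3) NfB[of B] NfB[of C] by blast
      have "B \<subseteq> C"
      proof (cases "B = b")
        case True
        obtain y where "y \<in> Y" using ne by blast
        then have "Some y \<in> f b" "Some y \<notin> f a" using disj fa' fb' by auto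
        then show ?thesis using 2[OF True] True BC(3) by blast
      next
        case False
        have "a \<inter> Y = {}" unfolding parts(2) using disj by blast
        then have "B \<inter> Y = {}" using Bq(2)[OF BC(1) _ False] by blast
        then show ?thesis using 1 by blast
      qed
      then show ?thesis using BC biclique_subset_eq by blast
    qed
    show "adj (delete_vertex (KB H) q) B C \<longleftrightarrow> f B \<inter> f C \<noteq> {}"
      if BC: "B \<in> ?F" "C \<in> ?F" "B \<noteq> C" for B C
    proof -
      have YZ: "D \<inter> Z \<noteq> {}" if "D \<in> ?F" "Some u \<in> f D" "u \<in> Y" for D u
      proof (cases "D = b")
        case True
        then show ?thesis unfolding True parts(3) using ne by blast
      next
        case False
        have "u \<notin> a" unfolding parts(2) using disj that(3) by blast
        then show ?thesis using Bq(2)[OF that(1) _ False] that SfB[of u D] by blast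
      qed
      \<comment> \<open>New common vertices of images can only be \<open>None\<close>, shared by the
        images of a and b alone, or vertices of Y, which occur only in images of bicliques
        containing Z. In each case Z already lies in both preimages.\<close>
      have "B \<inter> C \<noteq> {}" if m: "m \<in> f B" "m \<in> f C" for m
      proof (cases m)
        case None
        have "Z \<subseteq> a \<inter> b" using parts by blast
        moreover have "B = a \<or> B = b" "C = a \<or> C = b" using m None NfB by auto
        ultimately show ?thesis using ne BC(3) by blast
      next
        case (Some u)
        show ?thesis
        proof (cases "u \<in> Y")
          case True
          then have "Z \<subseteq> B" "Z \<subseteq> C" using YZ[OF BC(1)] YZ[OF BC(2)] twin BC m Some by blast+
          then show ?thesis using ne by blast
        qed (use m Some SfB[of u B] SfB[of u C] in blast)
      qed
      moreover have "f B \<inter> f C \<noteq> {}" if int: "B \<inter> C \<noteq> {}"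
      proof -
        obtain u where "u \<in> B" "u \<in> C" using int by blast
        then have "Some u \<in> f B \<inter> f C" using SfB[of u B] SfB[of u C] by blast
        then show ?thesis by blast
      qed
      ultimately show ?thesis using BC by (auto simp: adj_delete_vertex adj_KB)
    qed
  qed (auto simp: verts_delete_vertex verts_KB adj_delete_vertex adj_KB)
  have "simple_graph K" unfolding K_def
  proof (rule simple_graph_of)
    show "\<not> r m m" for m using irrefl disj by (auto simp: r_def split: option.splits)
  qed (use simple in \<open>auto simp: simple_graph_def\<close>)
  moreover have "connected_graph K"
  proof (rule connected_graph_map[OF connected, where f = Some])
    let ?R = "{(x, y). adj K x y}"
    obtain z where z: "z \<in> Z" using ne by blast
    have sR: "sym (?R\<^sup>*)"
      by (rule sym_rtrancl) (use adj_commute[of K] in \<open>auto simp: sym_def\<close>)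
    \<comment> \<open>The edges of H lost in K are those at Y, and they run to X and Z. Their ends
      are joined again through \<open>None\<close>, which sees Y and Z directly and reaches X
      through z.\<close>
    have N: "(None, Some v) \<in> ?R\<^sup>*" if "v \<in> X \<union> Y \<union> Z" for v
    proof (cases "v \<in> X")
      case True
      then have "(None, Some z) \<in> ?R" "(Some z, Some v) \<in> ?R" using z aN aZ by auto
      then show ?thesis by (meson r_into_rtrancl rtrancl_into_rtrancl)
    qed (use that aN in auto)
    have far: "(Some u, Some v) \<in> ?R\<^sup>*" if "u \<in> X \<union> Y \<union> Z" "v \<in> X \<union> Y \<union> Z" for u v
      using N[OF that(1)] N[OF that(2)] sR by (meson rtrancl_trans symD)
    show "(Some u, Some v) \<in> ?R\<^sup>*" if uv: "adj H u v" for u v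
    proof (cases "u \<in> Y \<or> v \<in> Y")
      case True
      then have "u \<in> X \<union> Y \<union> Z" "v \<in> X \<union> Y \<union> Z"
        using uv Y[of u v] Y[of v u] adj_commute[of H u v] by blast+
      then show ?thesis by (rule far)
    next
      case False
      then show ?thesis using uv aO by auto
    qed
    show "\<exists>u\<in>verts H. (Some u, w) \<in> ?R\<^sup>*" if "w \<in> verts K" for w
    proof (cases w)
      case None
      then have "(Some z, w) \<in> ?R" using aN z by auto
      then show ?thesis using z sub by blast
    next
      case (Some u)
      then show ?thesis using that SK by blast
    qed
  qed
  ultimately show "graph K" by (simp add: graph_def)
qed

end

theorem theorem2:
  fixes H :: "'a graph" and q :: "'a set"
  assumes "graph H"
    and "q \<in> verts (KB H)"
    and "degree (KB H) q = 2"
  shows "biclique_graph (delete_vertex (KB H) q)"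
proof -
  obtain a b where ab: "{p \<in> verts (KB H). adj (KB H) q p} = {a, b}" "a \<noteq> b"
    using assms(3) unfolding degree_def by (meson card_2_iff)
  then have nbr: "biclique H p \<and> p \<noteq> q \<and> q \<inter> p \<noteq> {} \<longleftrightarrow> p = a \<or> p = b" for p
    using assms(2) unfolding verts_KB adj_KB by blast
  have "degree_two_biclique H q a b"
  proof
    show "graph H" "biclique H q" using assms by (auto simp: verts_KB)
    show "biclique H a" "biclique H b" "q \<noteq> a" "q \<noteq> b" "a \<noteq> b" "q \<inter> a \<noteq> {}" "q \<inter> b \<noteq> {}"
      using nbr[of a] nbr[of b] ab(2) by auto
    show "B = q \<or> B = a \<or> B = b" if "biclique H B" "B \<inter> q \<noteq> {}" for B
      using nbr[of B] that by blast
  qed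
  then interpret D: degree_two_biclique H q a b .
  interpret D': degree_two_biclique H q b a by (rule D.swap)
  show ?thesis
  proof (cases "q \<inter> b \<subseteq> a \<or> q \<inter> a \<subseteq> b")
    case True
    then show ?thesis using D.biclique_graph_if_subset D'.biclique_graph_if_subset by blast
  next
    case False
    then obtain x1 x2 where x: "x1 \<in> q" "x1 \<in> a" "x1 \<notin> b" "x2 \<in> q" "x2 \<in> b" "x2 \<notin> a" by blast
    consider "D.stays a" "D.stays b" | "\<not> D.stays a" | "\<not> D.stays b" by blast
    then show ?thesis
    proof cases
      case 1
      then show ?thesis by (rule D.biclique_graph_if_stays)
    next
      case 2
      show ?thesis
        by (rule D.tripartite_if_not_stays[OF x 2]) (rule D.biclique_graph_if_tripartite)
    next
      case 3
      show ?thesis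
        by (rule D'.tripartite_if_not_stays[OF x(4-6,1-3) 3]) (rule D'.biclique_graph_if_tripartite)
    qed
  qed
qed

end
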